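(* Let $0<\alpha\le1$ and $a\in\mathbb{R}$. The $\mathbb{D}^{\alpha/2}$-fractional embedding of the continuous Euler-Lagrange equation associated to the Lagrangian density $$L(t,x,y,v,w)=\frac12v^2-\frac{a^2}{2}w^2$$ (one space dimension) is given by the fractional diffusion equation $$\mathbb{D}^{\alpha}u=a^2\frac{\partial^2u}{\partial x^2}.$$
   Context: Left fractional derivative in the time variable: for $\alpha>0$, $n\in\mathbb{N}$ with $n-1\le\alpha<n$, $\mathbb{D}^{\alpha}x(t)=\frac{1}{\Gamma(n-\alpha)}\frac{d^n}{dt^n}\int_{-\infty}^t(t-s)^{n-\alpha-1}x(s)\,ds$. On the function spaces considered in the paper (closures of $C_0^{\infty}(I)$, $I$ a bounded open interval, under the norm $(\|x\|_{L^2}^2+\|\mathbb{D}^{\beta}x\|_{L^2}^2)^{1/2}$) the semi-group property $\mathbb{D}^{\alpha}\mathbb{D}^{\beta-\alpha}=\mathbb{D}^{\beta}$, $0<\alpha<\beta$, holds and is used. The continuous Euler-Lagrange equation of a density $L(t,x,y,v,w)$ is $\frac{\partial L}{\partial y}-\frac{\partial}{\partial t}\left(\frac{\partial L}{\partial v}\right)-\frac{\partial}{\partial x}\left(\frac{\partial L}{\partial w}\right)=0$, with partial derivatives evaluated at $(t,x,u,\partial_tu,\partial_xu)$. Its $\mathbb{D}^{\sigma}$-fractional embedding ($\sigma>0$) is the equation obtained by replacing time derivatives by $\mathbb{D}^{\sigma}$: $\frac{\partial L}{\partial y}(z)-\mathbb{D}^{\sigma}\left[\frac{\partial L}{\partial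 v}(z)\right]-\frac{\partial}{\partial x}\left[\frac{\partial L}{\partial w}(z)\right]=0$ with $z=(t,x,u,\mathbb{D}^{\sigma}u,\partial_xu)$. *)

theory Defs
  imports "HOL-Analysis.Analysis"
begin

text \<open>Left fractional derivative of order \<open>\<sigma>\<close>, with \<open>n\<close> the integer such that
  \<open>n - 1 \<le> \<sigma> < n\<close>. As usual for functions that are only square integrable, it is a function
  determined almost everywhere; on a null set the total operator \<^const>\<open>deriv\<close> may
  return an unspecified value.\<close>

definition frac_deriv :: "real \<Rightarrow> (real \<Rightarrow> real) \<Rightarrow> real \<Rightarrow> real" where
  "frac_deriv \<sigma> x t =
     (let n = nat \<lfloor>\<sigma>\<rfloor> + 1
      in 1 / Gamma (real n - \<sigma>) *
         (deriv ^^ n) (\<lambda>\<tau>. LINT s:{..\<tau>}|lebesgue. (\<tau> - s) powr (real n - \<sigma> - 1) * x s) t)"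

definition test_functions :: "real set \<Rightarrow> (real \<Rightarrow> real) set" where
  "test_functions I =
     {\<phi>. (\<forall>k t. (deriv ^^ k) \<phi> field_differentiable (at t)) \<and>
         (\<exists>K. compact K \<and> K \<subseteq> I \<and> (\<forall>t. t \<notin> K \<longrightarrow> \<phi> t = 0))}"

definition L2 :: "real set \<Rightarrow> (real \<Rightarrow> real) set" where
  "L2 I = {f. f \<in> borel_measurable (lebesgue_on I) \<and> integrable (lebesgue_on I) (\<lambda>t. (f t)\<^sup>2)}"

definition L2_nrm :: "real set \<Rightarrow> (real \<Rightarrow> real) \<Rightarrow> real" where
  "L2_nrm I f = sqrt (LINT t|lebesgue_on I. (f t)\<^sup>2)"

text \<open>Closure of the test functions on \<open>I\<close> in the norm
  \<open>(\<parallel>x\<parallel>\<^sup>2 + \<parallel>D\<^sup>\<beta> x\<parallel>\<^sup>2)\<^sup>1\<^sup>/\<^sup>2\<close>, where both norms are those of \<open>L\<^sup>2(I)\<close>. Elements are extended by 0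
  outside \<open>I\<close>, so that the integral from \<open>-\<infinity>\<close> makes sense. By linearity the distance of
  \<open>\<phi>\<close> and \<open>x\<close> is written with \<open>D\<^sup>\<beta> \<phi> - D\<^sup>\<beta> x\<close>; this avoids applying the total operator
  \<^const>\<open>frac_deriv\<close> to a difference not yet known to have a fractional derivative.\<close>

definition frac_space :: "real \<Rightarrow> real set \<Rightarrow> (real \<Rightarrow> real) set" where
  "frac_space \<beta> I =
     {x. (\<forall>t. t \<notin> I \<longrightarrow> x t = 0) \<and> x \<in> L2 I \<and> frac_deriv \<beta> x \<in> L2 I \<and>
         (\<exists>\<phi> :: nat \<Rightarrow> real \<Rightarrow> real. (\<forall>k. \<phi> k \<in> test_functions I) \<and>
            (\<lambda>k. sqrt ((L2_nrm I (\<lambda>t. \<phi> k t - x t))\<^sup>2 +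
                       (L2_nrm I (\<lambda>t. frac_deriv \<beta> (\<phi> k) t - frac_deriv \<beta> x t))\<^sup>2))
              \<longlonglongrightarrow> 0)}"

text \<open>The Euler-Lagrange equation of \<open>L(t,x,y,v,w)\<close> at the point \<open>(t,x)\<close>, with the operator
  \<open>T\<close> in the place of every time derivative. Taking \<open>T = deriv\<close> gives the continuous
  Euler-Lagrange equation.\<close>

definition euler_lagrange ::
  "((real \<Rightarrow> real) \<Rightarrow> real \<Rightarrow> real) \<Rightarrow> (real \<Rightarrow> real \<Rightarrow> real \<Rightarrow> real \<Rightarrow> real \<Rightarrow> real) \<Rightarrow>
   (real \<Rightarrow> real \<Rightarrow> real) \<Rightarrow> real \<Rightarrow> real \<Rightarrow> bool" where
  "euler_lagrange T L u t x \<longleftrightarrow>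
     (let Tu = (\<lambda>s \<xi>. T (\<lambda>r. u r \<xi>) s);
          ux = (\<lambda>s \<xi>. deriv (u s) \<xi>);
          Ly = (\<lambda>s \<xi>. deriv (\<lambda>y. L s \<xi> y (Tu s \<xi>) (ux s \<xi>)) (u s \<xi>));
          Lv = (\<lambda>s \<xi>. deriv (\<lambda>v. L s \<xi> (u s \<xi>) v (ux s \<xi>)) (Tu s \<xi>));
          Lw = (\<lambda>s \<xi>. deriv (\<lambda>w. L s \<xi> (u s \<xi>) (Tu s \<xi>) w) (ux s \<xi>))
      in Ly t x - T (\<lambda>s. Lv s x) t - deriv (\<lambda>\<xi>. Lw t \<xi>) x = 0)"

definition frac_embedding ::
  "real \<Rightarrow> (real \<Rightarrow> real \<Rightarrow> real \<Rightarrow> real \<Rightarrow> real \<Rightarrow> real) \<Rightarrow>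
   (real \<Rightarrow> real \<Rightarrow> real) \<Rightarrow> real \<Rightarrow> real \<Rightarrow> bool" where
  "frac_embedding \<sigma> L = euler_lagrange (frac_deriv \<sigma>) L"

definition frac_diffusion ::
  "real \<Rightarrow> real \<Rightarrow> (real \<Rightarrow> real \<Rightarrow> real) \<Rightarrow> real \<Rightarrow> real \<Rightarrow> bool" where
  "frac_diffusion \<alpha> a u t x \<longleftrightarrow>
     frac_deriv \<alpha> (\<lambda>s. u s x) t = a\<^sup>2 * deriv (deriv (u t)) x"

end

theory Submission
  imports Defs
begin

text \<open>
For \<open>L = v\<^sup>2/2 - a\<^sup>2 w\<^sup>2/2\<close> the partial derivatives are \<open>L\<^sub>y = 0\<close>, \<open>L\<^sub>v = v\<close> and \<open>L\<^sub>w = - a\<^sup>2 w\<close>, so the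
embedded equation reads \<open>D\<^sup>\<sigma> D\<^sup>\<sigma> u = a\<^sup>2 u\<^sub>x\<^sub>x\<close> with \<open>\<sigma> = \<alpha>/2\<close> (lemma \<open>frac_embedding_quadratic\<close>). The
analytic content is the semigroup law \<open>D\<^sup>\<sigma> D\<^sup>\<alpha>\<^sup>-\<^sup>\<sigma> x = D\<^sup>\<alpha> x\<close> almost everywhere on the interval, for \<open>x\<close> in
the closure of the test functions (lemma \<open>frac_deriv_semigroup\<close>).

Write \<open>J\<^sup>\<gamma>\<close> for the Riemann-Liouville integral of order \<open>\<gamma>\<close>, so that \<open>D\<^sup>\<sigma> = (d/dt) J\<^sup>1\<^sup>-\<^sup>\<sigma>\<close> for \<open>\<sigma> < 1\<close>. Two
facts make the law true. First, \<open>J\<^sup>\<gamma> J\<^sup>\<delta> = J\<^sup>\<gamma>\<^sup>+\<^sup>\<delta>\<close> (lemma \<open>rl_integral_semigroup\<close>), by Fubini and the Beta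
integral; when \<open>\<gamma> + \<delta> \<ge> 1\<close> the kernel is bounded on bounded intervals and the identity holds at every
point, hence may be differentiated. Secondly, \<open>J\<^sup>1 h\<close> is differentiable almost everywhere with derivative
\<open>h\<close> (lemma \<open>rl_integral_1_has_derivative_AE\<close>).

The closure enters through the representation \<open>x = J\<^sup>\<alpha> g\<close> with \<open>g = D\<^sup>\<alpha> x\<close> (lemma
\<open>frac_space_representation\<close>). Test functions satisfy \<open>J\<^sup>1 \<phi> = J\<^sup>1\<^sup>+\<^sup>\<alpha> D\<^sup>\<alpha> \<phi>\<close>, and both sides are integrals
against bounded kernels, hence continuous in \<open>\<phi>\<close> and \<open>D\<^sup>\<alpha> \<phi>\<close> for the norm of \<open>L\<^sup>1\<close> on the interval, which
the norm of \<open>L\<^sup>2\<close> controls. So \<open>J\<^sup>1 x = J\<^sup>1\<^sup>+\<^sup>\<alpha> g = J\<^sup>1 (J\<^sup>\<alpha> g)\<close>, and differentiation gives \<open>x = J\<^sup>\<alpha> g\<close> almost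
everywhere.

From there, \<open>J\<^sup>1\<^sup>-\<^sup>\<alpha>\<^sup>+\<^sup>\<sigma> x = J\<^sup>1\<^sup>+\<^sup>\<sigma> g = J\<^sup>1 (J\<^sup>\<sigma> g)\<close> gives \<open>D\<^sup>\<alpha>\<^sup>-\<^sup>\<sigma> x = J\<^sup>\<sigma> g\<close>, and \<open>J\<^sup>1\<^sup>-\<^sup>\<sigma> (J\<^sup>\<sigma> g) = J\<^sup>1 g\<close> gives
\<open>D\<^sup>\<sigma> D\<^sup>\<alpha>\<^sup>-\<^sup>\<sigma> x = g = D\<^sup>\<alpha> x\<close>.
\<close>

section \<open>Riemann-Liouville kernels and integrals\<close>

text \<open>The kernel \<open>r\<^sup>\<gamma>\<^sup>-\<^sup>1 / \<Gamma>(\<gamma>)\<close> is extended by 0 to \<open>r \<le> 0\<close>, so that the fractional integral from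
  \<open>-\<infinity>\<close> to \<open>t\<close> becomes a convolution on the whole line.\<close>

definition rl_kernel :: "real \<Rightarrow> real \<Rightarrow> real" where
  "rl_kernel \<gamma> r = (if 0 < r then r powr (\<gamma> - 1) / Gamma \<gamma> else 0)"

definition rl_integral :: "real \<Rightarrow> (real \<Rightarrow> real) \<Rightarrow> real \<Rightarrow> real" where
  "rl_integral \<gamma> f t = (LINT s|lborel. rl_kernel \<gamma> (t - s) * f s)"

lemma rl_kernel_measurable [measurable]: "rl_kernel \<gamma> \<in> borel_measurable borel"
  unfolding rl_kernel_def by measurable

lemma rl_integral_measurable [measurable]:
  assumes [measurable]: "f \<in> borel_measurable borel"
  shows "rl_integral \<gamma> f \<in> borel_measurable borel"
  unfolding rl_integral_def by measurable

lemma rl_kernel_nonneg: "0 < \<gamma> \<Longrightarrow> 0 \<le> rl_kernel \<gamma> r"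
  by (simp add: rl_kernel_def Gamma_real_nonneg)

lemma rl_kernel_1: "rl_kernel 1 r = indicator {0<..} r"
  by (simp add: rl_kernel_def indicator_def)

lemma rl_kernel_mono:
  assumes "1 \<le> \<gamma>" and "r \<le> r'"
  shows "rl_kernel \<gamma> r \<le> rl_kernel \<gamma> r'"
  using assms unfolding rl_kernel_def
  by (auto intro!: divide_right_mono powr_mono2 Gamma_real_nonneg)

text \<open>The substitution \<open>r = s + (t - s) v\<close> turns the convolution into
  \<open>(t - s)\<^sup>\<gamma>\<^sup>+\<^sup>\<delta>\<^sup>-\<^sup>1\<close> times the Beta integral, and \<open>B(\<delta>, \<gamma>) = \<Gamma>(\<delta>) \<Gamma>(\<gamma>) / \<Gamma>(\<gamma> + \<delta>)\<close> supplies the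
  normalisation.\<close>

lemma nn_integral_rl_kernel_convolution:
  assumes "0 < \<gamma>" and "0 < \<delta>"
  shows "(\<integral>\<^sup>+ r. ennreal (rl_kernel \<gamma> (t - r) * rl_kernel \<delta> (r - s)) \<partial>lborel)
           = ennreal (rl_kernel (\<gamma> + \<delta>) (t - s))"
proof (cases "s < t")
  case False
  then have "rl_kernel \<gamma> (t - r) * rl_kernel \<delta> (r - s) = 0" for r
    by (auto simp: rl_kernel_def)
  moreover have "rl_kernel (\<gamma> + \<delta>) (t - s) = 0"
    using False by (simp add: rl_kernel_def)
  ultimately show ?thesis
    by (simp only: ennreal_0 nn_integral_0_iff_AE) simp
next
  case True
  \<comment> \<open>\<open>b\<close> is the Beta integrand on the unit interval, \<open>C\<close> collects the factors free of \<open>v\<close>.\<close>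
  define b where "b v = (v powr (\<delta> - 1) * (1 - v) powr (\<gamma> - 1)) * indicator {0..1} v" for v :: real
  define C where "C = (t - s) powr (\<gamma> + \<delta> - 2) / (Gamma \<gamma> * Gamma \<delta>)"
  have C: "0 \<le> C"
    using assms by (simp add: C_def Gamma_real_nonneg)
  have b[measurable]: "b \<in> borel_measurable borel"
    unfolding b_def by measurable
  have b0: "0 \<le> b v" for v
    by (simp add: b_def)
  have sub: "rl_kernel \<gamma> (t - (s + (t - s) * v)) * rl_kernel \<delta> (s + (t - s) * v - s) = C * b v" for v
  proof -
    have eq: "t - (s + (t - s) * v) = (t - s) * (1 - v)"
      by (simp add: algebra_simps)
    show ?thesis
    proof (cases "0 < v \<and> v < 1")
      case True
      moreover have "0 < (t - s) * (1 - v)" and "0 < (t - s) * v"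
        using True \<open>s < t\<close> by simp_all
      moreover have "(t - s) powr (\<gamma> + \<delta> - 2) = (t - s) powr (\<gamma> - 1) * (t - s) powr (\<delta> - 1)"
        by (simp add: powr_add[symmetric])
      ultimately show ?thesis
        unfolding eq using \<open>s < t\<close>
        by (simp add: rl_kernel_def b_def C_def powr_mult)
    next
      case False
      then have "b v = 0"
        by (cases "v = 0 \<or> v = 1") (auto simp: b_def)
      moreover have "\<not> (0 < (t - s) * (1 - v) \<and> 0 < (t - s) * v)"
        using False \<open>s < t\<close> by (auto simp: zero_less_mult_iff)
      ultimately show ?thesis
        unfolding eq by (auto simp: rl_kernel_def)
    qed
  qed
  have beta: "(\<integral>\<^sup>+ v. ennreal (b v) \<partial>lborel) = ennreal (Beta \<delta> \<gamma>)"
    using nn_integral_has_integral_lebesgue[OF _ has_integral_Beta_real[OF assms(2,1)]]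
    by (simp add: b_def mult.commute)
  have "(\<integral>\<^sup>+ r. ennreal (rl_kernel \<gamma> (t - r) * rl_kernel \<delta> (r - s)) \<partial>lborel)
          = ennreal (t - s) * (\<integral>\<^sup>+ v. ennreal (C * b v) \<partial>lborel)"
    using True
    by (subst nn_integral_real_affine[where t = s and c = "t - s"]) (simp_all only: sub, auto)
  also have "\<dots> = ennreal ((t - s) * (C * Beta \<delta> \<gamma>))"
    using True C b0 by (simp add: ennreal_mult' nn_integral_cmult beta)
  also have "(t - s) * (C * Beta \<delta> \<gamma>) = rl_kernel (\<gamma> + \<delta>) (t - s)"
  proof -
    have "Gamma \<gamma> \<noteq> 0" "Gamma \<delta> \<noteq> 0"
      using assms Gamma_real_pos by (auto simp: less_le)
    moreover have "(t - s) * (t - s) powr (\<gamma> + \<delta> - 2) = (t - s) powr (\<gamma> + \<delta> - 1)"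
      using True powr_mult_base[of "t - s" "\<gamma> + \<delta> - 2"] by (simp add: algebra_simps)
    ultimately show ?thesis
      using True by (simp add: rl_kernel_def C_def Beta_def add.commute field_simps)
  qed
  finally show ?thesis .
qed

lemma rl_kernel_convolution:
  assumes "0 < \<gamma>" and "0 < \<delta>"
  shows "has_bochner_integral lborel (\<lambda>r. rl_kernel \<gamma> (t - r) * rl_kernel \<delta> (r - s))
           (rl_kernel (\<gamma> + \<delta>) (t - s))"
  using assms
  by (intro has_bochner_integral_nn_integral nn_integral_rl_kernel_convolution)
     (auto intro!: AE_I2 mult_nonneg_nonneg rl_kernel_nonneg)

text \<open>The kernels are nonnegative, so by Tonelli the double integral of the absolute values
  collapses to a single integral against the kernel of order \<open>\<gamma> + \<delta>\<close>; its finiteness at the one point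
  \<open>t\<close> is all that Fubini requires. Having the identity pointwise, and not just almost everywhere, is
  what allows both sides to be differentiated afterwards.\<close>

lemma rl_integral_semigroup:
  assumes "0 < \<gamma>" and "0 < \<delta>"
    and f[measurable]: "f \<in> borel_measurable borel"
    and int: "integrable lborel (\<lambda>s. rl_kernel (\<gamma> + \<delta>) (t - s) * f s)"
  shows "integrable lborel (\<lambda>r. rl_kernel \<gamma> (t - r) * rl_integral \<delta> f r)"
    and "rl_integral \<gamma> (rl_integral \<delta> f) t = rl_integral (\<gamma> + \<delta>) f t"
proof -
  let ?H = "\<lambda>(s, r). (rl_kernel \<gamma> (t - r) * rl_kernel \<delta> (r - s)) * f s"
  have H: "integrable (lborel \<Otimes>\<^sub>M lborel) ?H"
  proof (rule lborel_pair.Fubini_integrable)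
    show "?H \<in> borel_measurable (lborel \<Otimes>\<^sub>M lborel)"
      by measurable
    have "(LINT r|lborel. norm (?H (s, r))) = norm (rl_kernel (\<gamma> + \<delta>) (t - s) * f s)" for s
      using rl_kernel_convolution[OF assms(1,2), of t s] assms(1,2)
      by (simp add: abs_mult rl_kernel_nonneg has_bochner_integral_iff)
    with int show "integrable lborel (\<lambda>s. LINT r|lborel. norm (?H (s, r)))"
      by (simp only: integrable_norm)
    show "AE s in lborel. integrable lborel (\<lambda>r. ?H (s, r))"
      using rl_kernel_convolution[OF assms(1,2)]
      by (auto intro!: integrable_mult_left simp: has_bochner_integral_iff)
  qed
  have inner: "(LINT s|lborel. ?H (s, r)) = rl_kernel \<gamma> (t - r) * rl_integral \<delta> f r" for r
    by (simp add: rl_integral_def mult.assoc)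
  show "integrable lborel (\<lambda>r. rl_kernel \<gamma> (t - r) * rl_integral \<delta> f r)"
    using lborel_pair.integrable_snd[of "\<lambda>s r. ?H (s, r)"] H by (simp only: inner) simp
  have "rl_integral \<gamma> (rl_integral \<delta> f) t = (LINT r|lborel. LINT s|lborel. ?H (s, r))"
    unfolding inner by (simp add: rl_integral_def)
  also have "\<dots> = (LINT s|lborel. LINT r|lborel. ?H (s, r))"
    using lborel_pair.Fubini_integral[of "\<lambda>s r. ?H (s, r)"] H by simp
  also have "\<dots> = rl_integral (\<gamma> + \<delta>) f t"
    using rl_kernel_convolution[OF assms(1,2)]
    by (simp add: rl_integral_def has_bochner_integral_iff)
  finally show "rl_integral \<gamma> (rl_integral \<delta> f) t = rl_integral (\<gamma> + \<delta>) f t" .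
qed

text \<open>From order 1 on the kernel is nondecreasing; to the right of \<open>c\<close> it is therefore bounded by
  its value at \<open>t - c\<close>.\<close>

lemma rl_kernel_mult_integrable:
  assumes \<gamma>: "1 \<le> \<gamma>" and f: "integrable lborel f" and c: "\<And>s. s \<le> c \<Longrightarrow> f s = 0"
  shows "integrable lborel (\<lambda>s. rl_kernel \<gamma> (t - s) * f s)"
proof (rule Bochner_Integration.integrable_bound)
  have [measurable]: "f \<in> borel_measurable borel"
    using f by auto
  show "integrable lborel (\<lambda>s. rl_kernel \<gamma> (t - c) * f s)"
    using f by simp
  show "(\<lambda>s. rl_kernel \<gamma> (t - s) * f s) \<in> borel_measurable lborel"
    by measurable
  have "\<bar>rl_kernel \<gamma> (t - s) * f s\<bar> \<le> \<bar>rl_kernel \<gamma> (t - c) * f s\<bar>" for s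
    using \<gamma> c[of s] rl_kernel_mono[OF \<gamma>, of "t - s" "t - c"]
    by (cases "s \<le> c") (auto simp: abs_mult rl_kernel_nonneg intro: mult_right_mono)
  then show "AE s in lborel. norm (rl_kernel \<gamma> (t - s) * f s) \<le> norm (rl_kernel \<gamma> (t - c) * f s)"
    by simp
qed

lemma rl_integral_eq_0:
  assumes "\<And>s. s < t \<Longrightarrow> f s = 0"
  shows "rl_integral \<gamma> f t = 0"
  unfolding rl_integral_def
  by (rule integral_eq_zero_AE) (use assms in \<open>auto simp: rl_kernel_def\<close>)

lemma rl_integral_cong:
  assumes "\<And>s. s < t \<Longrightarrow> f s = g s"
  shows "rl_integral \<gamma> f t = rl_integral \<gamma> g t"
  unfolding rl_integral_def
  by (rule Bochner_Integration.integral_cong) (use assms in \<open>auto simp: rl_kernel_def\<close>)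

text \<open>Compare \<open>h\<close> with \<open>M\<close> times the indicator of \<open>]c, \<infinity>[\<close>. That indicator is a translate of the
  kernel of order 1, so its fractional integral is the kernel of order \<open>\<gamma> + 1\<close>.\<close>

lemma rl_integral_bounded:
  assumes "0 < \<gamma>" and "c < d" and "0 \<le> M" and "\<And>s. \<bar>h s\<bar> \<le> M" and "\<And>s. s \<le> c \<Longrightarrow> h s = 0"
    and "t \<le> d"
  shows "\<bar>rl_integral \<gamma> h t\<bar> \<le> M * rl_kernel (\<gamma> + 1) (d - c)"
proof -
  have conv: "has_bochner_integral lborel (\<lambda>s. rl_kernel \<gamma> (t - s) * rl_kernel 1 (s - c)) (rl_kernel (\<gamma> + 1) (t - c))"
    by (rule rl_kernel_convolution) (use assms in auto)
  have "\<bar>rl_integral \<gamma> h t\<bar> \<le> (LINT s|lborel. \<bar>rl_kernel \<gamma> (t - s) * h s\<bar>)"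
    unfolding rl_integral_def by (rule integral_abs_bound)
  also have "\<dots> \<le> (LINT s|lborel. M * (rl_kernel \<gamma> (t - s) * rl_kernel 1 (s - c)))"
  proof (rule integral_mono')
    show "integrable lborel (\<lambda>s. M * (rl_kernel \<gamma> (t - s) * rl_kernel 1 (s - c)))"
      using conv by (simp add: has_bochner_integral_iff)
    show "\<bar>rl_kernel \<gamma> (t - s) * h s\<bar> \<le> M * (rl_kernel \<gamma> (t - s) * rl_kernel 1 (s - c))" for s
      using assms(5)[of s] assms(4)[of s] rl_kernel_nonneg[OF assms(1), of "t - s"]
      by (cases "s \<le> c") (auto simp: rl_kernel_1 abs_mult mult.commute[of M] intro: mult_left_mono)
    show "0 \<le> M * (rl_kernel \<gamma> (t - s) * rl_kernel 1 (s - c))" for s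
      using assms by (simp add: rl_kernel_nonneg)
  qed
  also have "\<dots> = M * rl_kernel (\<gamma> + 1) (t - c)"
    using conv by (simp add: has_bochner_integral_iff)
  also have "\<dots> \<le> M * rl_kernel (\<gamma> + 1) (d - c)"
    using assms by (intro mult_left_mono rl_kernel_mono) auto
  finally show ?thesis .
qed

text \<open>For \<open>\<gamma> \<ge> 1\<close> the kernel is bounded on the relevant range, so convergence in \<open>L\<^sup>1\<close> passes to
  the fractional integral at each point. Below order 1 this fails, which is why limits are taken only
  after one additional integration.\<close>

lemma rl_integral_tendsto:
  assumes \<gamma>: "1 \<le> \<gamma>" and f: "integrable lborel f" "\<And>s. s \<le> c \<Longrightarrow> f s = 0"
    and fk: "\<And>k. integrable lborel (fk k)" "\<And>k s. s \<le> c \<Longrightarrow> fk k s = 0"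
    and lim: "(\<lambda>k. LINT s|lborel. \<bar>fk k s - f s\<bar>) \<longlonglongrightarrow> 0"
  shows "(\<lambda>k. rl_integral \<gamma> (fk k) t) \<longlonglongrightarrow> rl_integral \<gamma> f t"
proof -
  have "norm (rl_integral \<gamma> (fk k) t - rl_integral \<gamma> f t)
          \<le> rl_kernel \<gamma> (t - c) * (LINT s|lborel. \<bar>fk k s - f s\<bar>)" for k
  proof -
    have "rl_integral \<gamma> (fk k) t - rl_integral \<gamma> f t = (LINT s|lborel. rl_kernel \<gamma> (t - s) * (fk k s - f s))"
      using rl_kernel_mult_integrable[OF \<gamma> f] rl_kernel_mult_integrable[OF \<gamma> fk]
      by (simp add: rl_integral_def right_diff_distrib)
    also have "\<bar>\<dots>\<bar> \<le> (LINT s|lborel. \<bar>rl_kernel \<gamma> (t - s) * (fk k s - f s)\<bar>)"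
      by (rule integral_abs_bound)
    also have "\<dots> \<le> (LINT s|lborel. rl_kernel \<gamma> (t - c) * \<bar>fk k s - f s\<bar>)"
    proof (rule integral_mono')
      fix s
      show "\<bar>rl_kernel \<gamma> (t - s) * (fk k s - f s)\<bar> \<le> rl_kernel \<gamma> (t - c) * \<bar>fk k s - f s\<bar>"
        using \<gamma> f(2)[of s] fk(2)[of s k] rl_kernel_mono[OF \<gamma>, of "t - s" "t - c"]
        by (cases "s \<le> c") (auto simp: abs_mult rl_kernel_nonneg intro: mult_right_mono)
      show "integrable lborel (\<lambda>s. rl_kernel \<gamma> (t - c) * \<bar>fk k s - f s\<bar>)"
        using f(1) fk(1) by (intro integrable_mult_right integrable_abs Bochner_Integration.integrable_diff)
      show "0 \<le> rl_kernel \<gamma> (t - c) * \<bar>fk k s - f s\<bar>"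
        using \<gamma> by (simp add: rl_kernel_nonneg)
    qed
    finally show ?thesis by simp
  qed
  then have "\<forall>\<^sub>F k in sequentially. norm (rl_integral \<gamma> (fk k) t - rl_integral \<gamma> f t)
          \<le> rl_kernel \<gamma> (t - c) * (LINT s|lborel. \<bar>fk k s - f s\<bar>)"
    by (intro always_eventually allI)
  then have "(\<lambda>k. rl_integral \<gamma> (fk k) t - rl_integral \<gamma> f t) \<longlonglongrightarrow> 0"
    by (rule Lim_null_comparison[OF _ tendsto_mult_right_zero[OF lim]])
  then show ?thesis
    by (rule LIM_zero_cancel)
qed

section \<open>Differentiation of the integral of order one\<close>

lemma rl_integral_1: "rl_integral 1 h t = (LINT s:{..<t}|lborel. h s)"
  unfolding rl_integral_def rl_kernel_1 set_lebesgue_integral_def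
  by (intro Bochner_Integration.integral_cong) (auto simp: indicator_def)

lemma rl_integral_1_diff:
  assumes int: "\<And>t. integrable lborel (\<lambda>s. rl_kernel 1 (t - s) * h s)"
  shows "h integrable_on {a..b}"
    and "a \<le> b \<Longrightarrow> rl_integral 1 h b - rl_integral 1 h a = integral {a..b} h"
proof -
  have si: "set_integrable lborel {..<t} h" for t
    using int[of t] unfolding set_integrable_def rl_kernel_1
    by (rule Bochner_Integration.integrable_cong[THEN iffD1, rotated 2]) (auto simp: indicator_def)
  have si': "set_integrable lborel {a..b} h"
    by (rule set_integrable_subset[OF si[of "b + 1"]]) auto
  show "h integrable_on {a..b}"
    using set_borel_integral_eq_integral(1)[OF si'] .
  assume "a \<le> b"
  have ab: "set_integrable lborel {a..<b} h"
    by (rule set_integrable_subset[OF si[of b]]) auto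
  have "rl_integral 1 h b = (LINT s:{..<a} \<union> {a..<b}|lborel. h s)"
    using \<open>a \<le> b\<close> by (simp add: rl_integral_1 ivl_disj_un)
  also have "\<dots> = rl_integral 1 h a + (LINT s:{a..<b}|lborel. h s)"
    by (subst set_integral_Un[OF _ si ab]) (auto simp: rl_integral_1)
  also have "(LINT s:{a..<b}|lborel. h s) = (LINT s:{a..b}|lborel. h s)"
    by (rule set_integral_discrete_difference[where X = "{b}"]) auto
  also have "\<dots> = integral {a..b} h"
    using set_borel_integral_eq_integral(2)[OF si'] .
  finally show "rl_integral 1 h b - rl_integral 1 h a = integral {a..b} h"
    by simp
qed

text \<open>One half of Lebesgue's differentiation theorem: differentiation along the cubes
  \<open>[x, x + h]\<^sup>n\<close>, which in dimension one lie to the right of the point.\<close>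

lemma right_derivative_indefinite_integral:
  fixes h :: "real \<Rightarrow> real"
  assumes "\<And>a b. h integrable_on {a..b}"
  shows "AE t in lborel. ((\<lambda>r. integral {t..t + r} h / r) \<longlongrightarrow> h t) (at_right 0)"
proof -
  obtain N where N: "negligible N" and
    lim: "\<And>x e. \<lbrakk>x \<notin> N; 0 < e\<rbrakk> \<Longrightarrow> \<exists>d>0. \<forall>r. 0 < r \<and> r < d \<longrightarrow>
            norm (integral (cbox x (x + r *\<^sub>R One)) h /\<^sub>R r ^ DIM(real) - h x) < e"
    using integrable_ccontinuous_explicit[of h] assms by auto
  have "((\<lambda>r. integral {t..t + r} h / r) \<longlongrightarrow> h t) (at_right 0)" if "t \<notin> N" for t
    unfolding tendsto_iff
  proof (intro allI impI)
    fix e :: real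
    assume "0 < e"
    from lim[OF that this] obtain \<delta> where "\<delta> > 0"
      and "\<And>r. 0 < r \<Longrightarrow> r < \<delta> \<Longrightarrow> norm (integral (cbox t (t + r *\<^sub>R One)) h /\<^sub>R r ^ DIM(real) - h t) < e"
      by auto
    then show "\<forall>\<^sub>F r in at_right 0. dist (integral {t..t + r} h / r) (h t) < e"
      unfolding eventually_at_right_field
      by (intro exI[of _ \<delta>]) (simp add: dist_norm divide_inverse mult.commute)
  qed
  then have "AE t in lebesgue. ((\<lambda>r. integral {t..t + r} h / r) \<longlongrightarrow> h t) (at_right 0)"
    using N by (intro AE_I'[of N]) (auto simp: negligible_iff_null_sets)
  then show ?thesis
    by (simp add: AE_completion_iff)
qed

lemma AE_lborel_uminus:
  assumes "AE t in lborel. P (t::real)"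
  shows "AE t in lborel. P (- t)"
proof -
  obtain N where "N \<in> null_sets lborel" and N: "{t. \<not> P t} \<subseteq> N"
    using assms by (auto simp: eventually_ae_filter)
  then have "AE t in lborel. t \<notin> N" and [measurable]: "N \<in> sets borel"
    by (auto intro: AE_not_in)
  then have "AE t in distr lborel borel uminus. (t::real) \<notin> N"
    by (subst lborel_distr_uminus)
  then have "AE t in lborel. - t \<notin> N"
    by (subst (asm) AE_distr_iff) auto
  then show ?thesis
    by eventually_elim (use N in auto)
qed

text \<open>Lebesgue's differentiation theorem on the line. The left derivative of the integral of \<open>h\<close>
  at \<open>t\<close> is the right derivative of the integral of the reflected function \<open>h(- s)\<close> at \<open>- t\<close>.\<close>

lemma rl_integral_1_has_derivative_AE:
  assumes int: "\<And>t. integrable lborel (\<lambda>s. rl_kernel 1 (t - s) * h s)"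
  shows "AE t in lborel. (rl_integral 1 h has_real_derivative h t) (at t)"
proof -
  let ?F = "rl_integral 1 h"
  note hk = rl_integral_1_diff(1)[OF int] and F = rl_integral_1_diff(2)[OF int]
  have hk': "(\<lambda>s. h (- s)) integrable_on {a..b}" for a b
    using hk[of "-b" "-a"] Henstock_Kurzweil_Integration.integrable_reflect_real[of h "-a" "-b"] by simp
  have right: "AE t in lborel. ((\<lambda>r. integral {t..t + r} h / r) \<longlongrightarrow> h t) (at_right 0)"
    by (rule right_derivative_indefinite_integral[OF hk])
  have "AE t in lborel. ((\<lambda>r. integral {- t..- t + r} (\<lambda>s. h (- s)) / r) \<longlongrightarrow> h t) (at_right 0)"
    using AE_lborel_uminus[OF right_derivative_indefinite_integral[OF hk']] by simp
  with right show ?thesis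
  proof eventually_elim
    case (elim t)
    have ev0: "eventually (\<lambda>r::real. 0 < r) (at_right 0)"
      by (simp add: eventually_at_right_less)
    have "((\<lambda>r. (?F (t + r) - ?F t) / r) \<longlongrightarrow> h t) (at_right 0)"
      using elim(1) by (rule Lim_transform_eventually) (use ev0 in eventually_elim, simp add: F)
    moreover have "((\<lambda>r. (?F (t + - r) - ?F t) / - r) \<longlongrightarrow> h t) (at_right 0)"
      using elim(2)
    proof (rule Lim_transform_eventually)
      show "\<forall>\<^sub>F r in at_right 0. integral {- t..- t + r} (\<lambda>s. h (- s)) / r = (?F (t + - r) - ?F t) / - r"
        using ev0
      proof eventually_elim
        case (elim r)
        have "integral {- t..- (t - r)} (\<lambda>s. h (- s)) = integral {t - r..t} h"
          by (rule Henstock_Kurzweil_Integration.integral_reflect_real)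
        with elim F[of "t - r" t] show ?case by (simp add: field_simps)
      qed
    qed
    then have "((\<lambda>r. (?F (t + r) - ?F t) / r) \<longlongrightarrow> h t) (at_left 0)"
      by (subst at_left_minus) (simp add: filterlim_filtermap)
    ultimately have "((\<lambda>r. (?F (t + r) - ?F t) / r) \<longlongrightarrow> h t) (at 0)"
      using filterlim_split_at by blast
    then show ?case
      by (simp add: DERIV_def)
  qed
qed

lemma rl_integral_1_has_derivative_continuous:
  assumes int: "\<And>t. integrable lborel (\<lambda>s. rl_kernel 1 (t - s) * h s)" and h: "continuous_on UNIV h"
  shows "(rl_integral 1 h has_real_derivative h t) (at t)"
proof -
  have "((\<lambda>x. integral {t - 1..x} h) has_real_derivative h t) (at t within {t - 1..t + 1})"
    using h by (intro integral_has_real_derivative continuous_on_subset[OF h]) auto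
  then have "((\<lambda>x. integral {t - 1..x} h) has_real_derivative h t) (at t)"
    by (simp add: at_within_Icc_at)
  then have "((\<lambda>x. rl_integral 1 h (t - 1) + integral {t - 1..x} h) has_real_derivative 0 + h t) (at t)"
    by (intro DERIV_add DERIV_const)
  then have "((\<lambda>x. rl_integral 1 h (t - 1) + integral {t - 1..x} h) has_real_derivative h t) (at t)"
    by simp
  moreover have "rl_integral 1 h (t - 1) + integral {t - 1..x} h = rl_integral 1 h x" if "x \<in> {t - 1<..}" for x
    using rl_integral_1_diff(2)[OF int, of "t - 1" x] that by simp
  ultimately show ?thesis
    using has_field_derivative_transform_within_open[of _ _ t "{t - 1<..}"] by simp
qed

section \<open>Fractional derivatives as derivatives of Riemann-Liouville integrals\<close>

text \<open>Only the values before \<open>d\<close> enter, up to a null set; thus a function that is known merely on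
  \<open>]-\<infinity>, d[\<close> and almost everywhere can be replaced by a Borel function, for which Fubini's theorem is
  at hand. The kernels agree even at \<open>s = t\<close>, because \<open>0 powr p = 0\<close> for every \<open>p\<close>.\<close>

lemma frac_integral_eq_rl_integral:
  assumes \<gamma>: "0 < \<gamma>" and [measurable]: "f \<in> borel_measurable borel"
    and eq: "AE s in lborel. s < d \<longrightarrow> x s = f s" and "t < d"
  shows "(LINT s:{..t}|lebesgue. (t - s) powr (\<gamma> - 1) * x s) = Gamma \<gamma> * rl_integral \<gamma> f t"
proof -
  let ?k = "\<lambda>s. Gamma \<gamma> * (rl_kernel \<gamma> (t - s) * f s)"
  have [simp]: "Gamma \<gamma> \<noteq> 0"
    using Gamma_real_pos[OF \<gamma>] by simp
  have ae: "AE s in lebesgue. ?k s = indicator {..t} s * ((t - s) powr (\<gamma> - 1) * x s)"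
    using AE_completion[OF eq]
    by eventually_elim (use \<open>t < d\<close> in \<open>auto simp: rl_kernel_def indicator_def\<close>)
  have k[measurable]: "?k \<in> borel_measurable lborel"
    by measurable
  then have "?k \<in> borel_measurable lebesgue"
    by (rule measurable_completion)
  from this borel_measurable_AE[OF this ae]
  have "(LINT s:{..t}|lebesgue. (t - s) powr (\<gamma> - 1) * x s) = (LINT s|lebesgue. ?k s)"
    unfolding set_lebesgue_integral_def
    by (intro integral_cong_AE) (use ae in \<open>auto simp: eq_commute\<close>)
  also have "\<dots> = (LINT s|lborel. ?k s)"
    by (rule integral_completion[OF k])
  finally show ?thesis
    by (simp add: rl_integral_def)
qed

text \<open>The derivative is taken at a point where it is known to exist, which rules out an unspecified
  value of \<^const>\<open>deriv\<close>.\<close>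

lemma frac_deriv_eqI:
  assumes \<sigma>: "0 \<le> \<sigma>" "\<sigma> < 1" and f: "f \<in> borel_measurable borel"
    and eq: "AE s in lborel. s < d \<longrightarrow> x s = f s" and "t < d"
    and D: "(rl_integral (1 - \<sigma>) f has_real_derivative D) (at t)"
  shows "frac_deriv \<sigma> x t = D"
proof -
  let ?G = "\<lambda>\<tau>. LINT s:{..\<tau>}|lebesgue. (\<tau> - s) powr (1 - \<sigma> - 1) * x s"
  have [simp]: "nat \<lfloor>\<sigma>\<rfloor> = 0"
    using \<sigma> by simp
  have "((\<lambda>\<tau>. Gamma (1 - \<sigma>) * rl_integral (1 - \<sigma>) f \<tau>) has_real_derivative Gamma (1 - \<sigma>) * D) (at t)"
    by (rule DERIV_cmult[OF D])
  then have "(?G has_real_derivative Gamma (1 - \<sigma>) * D) (at t)"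
    by (rule has_field_derivative_transform_within_open[of _ _ _ "{..<d}"])
       (use \<sigma> \<open>t < d\<close> frac_integral_eq_rl_integral[OF _ f eq, of "1 - \<sigma>"] in auto)
  then have "deriv ?G t = Gamma (1 - \<sigma>) * D"
    by (rule DERIV_imp_deriv)
  moreover have "Gamma (1 - \<sigma>) \<noteq> 0"
    using Gamma_real_pos[of "1 - \<sigma>"] \<sigma> by (simp add: less_imp_neq[symmetric])
  ultimately show ?thesis
    by (simp add: frac_deriv_def Let_def)
qed

section \<open>Square integrable functions on a bounded interval\<close>

lemma bounded_supported_integrable:
  fixes h :: "real \<Rightarrow> real"
  assumes [measurable]: "h \<in> borel_measurable borel"
    and supp: "\<And>s. s \<notin> {c<..<d} \<Longrightarrow> h s = 0" and bd: "\<exists>M. \<forall>s. \<bar>h s\<bar> \<le> M"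
  shows "integrable lborel h"
proof -
  obtain M where M: "\<And>s. \<bar>h s\<bar> \<le> M"
    using bd by auto
  have le: "norm (h s) \<le> norm (M * indicator {c<..<d} s)" for s
    using supp[of s] M[of s] by (cases "s \<in> {c<..<d}") auto
  have "integrable lborel (\<lambda>s. M * indicator {c<..<d} s)"
    by (intro integrable_mult_right integrable_real_indicator emeasure_bounded_finite) auto
  then show ?thesis
    by (rule Bochner_Integration.integrable_bound) (use le in \<open>simp_all add: AE_I2\<close>)
qed

lemma L2_borel_representative:
  assumes "h \<in> L2 {c<..<d}"
  obtains h' where "h' \<in> borel_measurable borel" "\<And>s. s \<notin> {c<..<d} \<Longrightarrow> h' s = 0"
    "AE s in lborel. s \<in> {c<..<d} \<longrightarrow> h s = h' s" "integrable lborel (\<lambda>s. (h' s)\<^sup>2)"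
proof -
  let ?I = "{c<..<d}"
  have "(\<lambda>s. indicator ?I s *\<^sub>R h s) \<in> borel_measurable lebesgue"
    using assms borel_measurable_restrict_space_iff[of ?I lebesgue h]
    by (simp add: L2_def mult.commute)
  then obtain g where [measurable]: "g \<in> borel_measurable lborel"
    and g: "AE s in lborel. indicator ?I s *\<^sub>R h s = g s"
    using completion_ex_borel_measurable_real by blast
  let ?h = "\<lambda>s. indicator ?I s * g s"
  show thesis
  proof
    show "?h \<in> borel_measurable borel"
      by measurable
    show "?h s = 0" if "s \<notin> ?I" for s
      using that by simp
    show eq: "AE s in lborel. s \<in> ?I \<longrightarrow> h s = ?h s"
      using g by eventually_elim auto
    have a: "integrable lebesgue (\<lambda>s. indicator ?I s *\<^sub>R (h s)\<^sup>2)"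
      using assms by (simp add: L2_def integrable_restrict_space)
    have b: "AE s in lebesgue. indicator ?I s *\<^sub>R (h s)\<^sup>2 = (?h s)\<^sup>2"
      using AE_completion[OF eq] by eventually_elim (auto simp: indicator_def)
    have m: "(\<lambda>s. (?h s)\<^sup>2) \<in> borel_measurable lborel"
      by measurable
    have "integrable lebesgue (\<lambda>s. (?h s)\<^sup>2)"
      by (rule integrable_cong_AE_imp[OF a measurable_completion[OF m] b])
    then show "integrable lborel (\<lambda>s. (?h s)\<^sup>2)"
      using m by (simp add: integrable_completion)
  qed
qed

lemma L2_nrm_eq_integral:
  assumes [measurable]: "h' \<in> borel_measurable borel" and "\<And>s. s \<notin> {c<..<d} \<Longrightarrow> h' s = 0"
    and eq: "AE s in lborel. s \<in> {c<..<d} \<longrightarrow> h s = h' s"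
  shows "L2_nrm {c<..<d} h = sqrt (LINT s|lborel. (h' s)\<^sup>2)"
proof -
  have ae: "AE s in lebesgue. (h' s)\<^sup>2 = indicator {c<..<d} s *\<^sub>R (h s)\<^sup>2"
    using AE_completion[OF eq] by eventually_elim (use assms(2) in \<open>auto simp: indicator_def\<close>)
  have m: "(\<lambda>s. (h' s)\<^sup>2) \<in> borel_measurable lborel"
    by measurable
  then have m': "(\<lambda>s. (h' s)\<^sup>2) \<in> borel_measurable lebesgue"
    by (rule measurable_completion)
  have "(LINT s|lebesgue_on {c<..<d}. (h s)\<^sup>2) = (LINT s|lebesgue. indicator {c<..<d} s *\<^sub>R (h s)\<^sup>2)"
    by (simp add: integral_restrict_space)
  also have "\<dots> = (LINT s|lebesgue. (h' s)\<^sup>2)"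
    using ae m' borel_measurable_AE[OF m' ae] by (intro integral_cong_AE) (auto simp: eq_commute)
  also have "\<dots> = (LINT s|lborel. (h' s)\<^sup>2)"
    by (rule integral_completion[OF m])
  finally show ?thesis
    by (simp add: L2_nrm_def)
qed

text \<open>Cauchy-Schwarz for the pair \<open>\<bar>h\<bar>\<close> and 1 on an interval of finite length.\<close>

lemma L1_le_L2_on_interval:
  assumes "c < d" and [measurable]: "h \<in> borel_measurable borel"
    and supp: "\<And>s. s \<notin> {c<..<d} \<Longrightarrow> h s = 0" and sq: "integrable lborel (\<lambda>s. (h s)\<^sup>2)"
  shows "integrable lborel h"
    and "(LINT s|lborel. \<bar>h s\<bar>) \<le> sqrt (d - c) * sqrt (LINT s|lborel. (h s)\<^sup>2)"
proof -
  let ?I = "indicator {c<..<d} :: real \<Rightarrow> real"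
  have I: "integrable lborel ?I" "(LINT s|lborel. ?I s) = d - c"
    using \<open>c < d\<close> by (auto intro!: integrable_real_indicator)
  show int: "integrable lborel h"
  proof (rule Bochner_Integration.integrable_bound)
    show "integrable lborel (\<lambda>s. ?I s + (h s)\<^sup>2)"
      using I sq by simp
    have "\<bar>h s\<bar> \<le> \<bar>?I s + (h s)\<^sup>2\<bar>" for s
    proof (cases "s \<in> {c<..<d}")
      case True
      have "0 \<le> (\<bar>h s\<bar> - 1)\<^sup>2 + \<bar>h s\<bar>"
        by simp
      with True show ?thesis by (simp add: power2_diff)
    qed (simp add: supp)
    then show "AE s in lborel. norm (h s) \<le> norm (?I s + (h s)\<^sup>2)"
      by simp
  qed simp
  define A where "A = (LINT s|lborel. \<bar>h s\<bar>)"
  define B where "B = (LINT s|lborel. (h s)\<^sup>2)"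
  define l where "l = d - c"
  have "l > 0"
    using \<open>c < d\<close> by (simp add: l_def)
  \<comment> \<open>Expand the square of the deviation of \<open>\<bar>h\<bar>\<close> from its mean value \<open>A / l\<close>.\<close>
  have "(\<bar>h s\<bar> - A / l * ?I s)\<^sup>2 = (h s)\<^sup>2 - 2 * (A / l) * \<bar>h s\<bar> + (A / l)\<^sup>2 * ?I s" for s
    by (cases "s \<in> {c<..<d}") (auto simp: supp power2_diff)
  then have "(LINT s|lborel. (\<bar>h s\<bar> - A / l * ?I s)\<^sup>2) = B - 2 * (A / l) * A + (A / l)\<^sup>2 * l"
    using int sq I by (simp add: A_def B_def l_def)
  moreover have "0 \<le> (LINT s|lborel. (\<bar>h s\<bar> - A / l * ?I s)\<^sup>2)"
    by (rule Bochner_Integration.integral_nonneg) simp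
  ultimately have "0 \<le> B - 2 * (A / l) * A + (A / l)\<^sup>2 * l"
    by simp
  also have "\<dots> = B - A\<^sup>2 / l"
    using \<open>l > 0\<close> by (simp add: field_simps power2_eq_square)
  finally have "A\<^sup>2 \<le> l * B"
    using \<open>l > 0\<close> by (simp add: field_simps)
  then have "A \<le> sqrt (l * B)"
    by (rule real_le_rsqrt)
  then show "(LINT s|lborel. \<bar>h s\<bar>) \<le> sqrt (d - c) * sqrt (LINT s|lborel. (h s)\<^sup>2)"
    by (simp add: A_def B_def l_def real_sqrt_mult)
qed

text \<open>Convergence in the norm of \<open>L\<^sup>2\<close> is stated for functions given almost everywhere and is
  transferred to convergence in \<open>L\<^sup>1\<close> of Borel representatives. Boundedness of the approximating functions
  ensures that the differences are square integrable, so that their norm is not the default value 0 of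
  a divergent integral.\<close>

lemma L1_tendsto_if_L2_nrm_tendsto:
  assumes "c < d" and [measurable]: "f \<in> borel_measurable borel"
    and f0: "\<And>s. s \<notin> {c<..<d} \<Longrightarrow> f s = 0" and f2: "integrable lborel (\<lambda>s. (f s)\<^sup>2)"
    and h: "AE s in lborel. s \<in> {c<..<d} \<longrightarrow> h s = f s"
    and [measurable]: "\<And>k. fk k \<in> borel_measurable borel"
    and fk0: "\<And>k s. s \<notin> {c<..<d} \<Longrightarrow> fk k s = 0" and bd: "\<And>k. \<exists>M. \<forall>s. \<bar>fk k s\<bar> \<le> M"
    and hk: "\<And>k. AE s in lborel. s \<in> {c<..<d} \<longrightarrow> hk k s = fk k s"
    and lim: "(\<lambda>k::nat. L2_nrm {c<..<d} (\<lambda>s. hk k s - h s)) \<longlonglongrightarrow> 0"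
  shows "(\<lambda>k. LINT s|lborel. \<bar>fk k s - f s\<bar>) \<longlonglongrightarrow> 0"
proof (rule tendsto_sandwich[OF _ _ tendsto_const])
  show "(\<lambda>k. sqrt (d - c) * L2_nrm {c<..<d} (\<lambda>s. hk k s - h s)) \<longlonglongrightarrow> 0"
    using tendsto_mult_right_zero[OF lim] .
  show "\<forall>\<^sub>F k in sequentially. 0 \<le> (LINT s|lborel. \<bar>fk k s - f s\<bar>)"
    by simp
  show "\<forall>\<^sub>F k in sequentially. (LINT s|lborel. \<bar>fk k s - f s\<bar>)
          \<le> sqrt (d - c) * L2_nrm {c<..<d} (\<lambda>s. hk k s - h s)"
  proof (intro always_eventually allI)
    fix k
    have "AE s in lborel. s \<in> {c<..<d} \<longrightarrow> hk k s - h s = fk k s - f s"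
      using h hk[of k] by eventually_elim simp
    then have nrm: "L2_nrm {c<..<d} (\<lambda>s. hk k s - h s) = sqrt (LINT s|lborel. (fk k s - f s)\<^sup>2)"
      by (rule L2_nrm_eq_integral[rotated 2]) (auto simp: f0 fk0)
    have "integrable lborel (\<lambda>s. (fk k s)\<^sup>2)"
    proof (rule bounded_supported_integrable[where c = c and d = d])
      obtain M where "\<And>s. \<bar>fk k s\<bar> \<le> M"
        using bd by blast
      then have "\<bar>(fk k s)\<^sup>2\<bar> \<le> M\<^sup>2" for s
        using power_mono[of "\<bar>fk k s\<bar>" M 2] by simp
      then show "\<exists>M. \<forall>s. \<bar>(fk k s)\<^sup>2\<bar> \<le> M"
        by blast
    qed (auto simp: fk0)
    with f2 have "integrable lborel (\<lambda>s. 2 * (fk k s)\<^sup>2 + 2 * (f s)\<^sup>2)"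
      by simp
    then have "integrable lborel (\<lambda>s. (fk k s - f s)\<^sup>2)"
    proof (rule Bochner_Integration.integrable_bound)
      have "(fk k s - f s)\<^sup>2 \<le> 2 * (fk k s)\<^sup>2 + 2 * (f s)\<^sup>2" for s
        using zero_le_power2[of "fk k s + f s"] by (simp add: power2_eq_square algebra_simps)
      then show "AE s in lborel. norm ((fk k s - f s)\<^sup>2) \<le> norm (2 * (fk k s)\<^sup>2 + 2 * (f s)\<^sup>2)"
        by simp
    qed simp
    then show "(LINT s|lborel. \<bar>fk k s - f s\<bar>) \<le> sqrt (d - c) * L2_nrm {c<..<d} (\<lambda>s. hk k s - h s)"
      unfolding nrm by (intro L1_le_L2_on_interval(2)) (auto simp: \<open>c < d\<close> f0 fk0)
  qed
qed

section \<open>Test functions\<close>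

lemma test_function_properties:
  assumes "\<phi> \<in> test_functions {c<..<d}"
  shows "continuous_on UNIV \<phi>" and "continuous_on UNIV (deriv \<phi>)"
    and "\<And>t. (\<phi> has_real_derivative deriv \<phi> t) (at t)"
    and "\<And>t. t \<notin> {c<..<d} \<Longrightarrow> \<phi> t = 0" and "\<And>t. t \<notin> {c<..<d} \<Longrightarrow> deriv \<phi> t = 0"
proof -
  from assms obtain K where diff: "\<And>k t. (deriv ^^ k) \<phi> field_differentiable (at t)"
    and K: "compact K" "K \<subseteq> {c<..<d}" "\<And>t. t \<notin> K \<Longrightarrow> \<phi> t = 0"
    by (auto simp: test_functions_def)
  have D: "\<phi> field_differentiable (at t)" "deriv \<phi> field_differentiable (at t)" for t
    using diff[of 0 t] diff[of 1 t] by simp_all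
  then show "continuous_on UNIV \<phi>" "continuous_on UNIV (deriv \<phi>)"
    by (auto intro!: continuous_at_imp_continuous_on field_differentiable_imp_continuous_at)
  show "(\<phi> has_real_derivative deriv \<phi> t) (at t)" for t
    using D(1) by (rule field_differentiable_derivI)
  show "\<phi> t = 0" if "t \<notin> {c<..<d}" for t
    using that K(2) by (intro K(3)) auto
  show "deriv \<phi> t = 0" if "t \<notin> {c<..<d}" for t
  proof -
    have "(\<phi> has_real_derivative 0) (at t)"
      by (rule has_field_derivative_transform_within_open[of "\<lambda>_. 0" _ _ "- K"])
         (use that K compact_imp_closed[OF K(1)] in auto)
    then show ?thesis
      by (rule DERIV_imp_deriv)
  qed
qed

lemma continuous_supported_integrable:
  fixes h :: "real \<Rightarrow> real"
  assumes "continuous_on UNIV h" and "\<And>t. t \<notin> {c<..<d} \<Longrightarrow> h t = 0"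
  shows "integrable lborel h" and "h \<in> borel_measurable borel" and "\<exists>M\<ge>0. \<forall>t. \<bar>h t\<bar> \<le> M"
proof -
  have c: "continuous_on {c..d} h"
    using assms(1) by (rule continuous_on_subset) simp
  have "integrable lborel (\<lambda>t. indicator {c..d} t *\<^sub>R h t)"
    using borel_integrable_compact[OF compact_Icc c] .
  moreover have "(\<lambda>t. indicator {c..d} t *\<^sub>R h t) = h"
  proof
    fix t
    show "indicator {c..d} t *\<^sub>R h t = h t"
      using assms(2)[of t] by (cases "t \<in> {c<..<d}") auto
  qed
  ultimately show "integrable lborel h"
    by simp
  then show "h \<in> borel_measurable borel"
    by auto
  have "bounded (h ` {c..d})"
    using compact_continuous_image[OF c] compact_imp_bounded by blast
  then obtain M where M: "M > 0" "\<And>t. t \<in> {c..d} \<Longrightarrow> \<bar>h t\<bar> \<le> M"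
    unfolding bounded_pos by auto
  have "\<bar>h t\<bar> \<le> M" for t
    using M assms(2)[of t] by (cases "t \<in> {c<..<d}") auto
  with M(1) show "\<exists>M\<ge>0. \<forall>t. \<bar>h t\<bar> \<le> M"
    by (intro exI[of _ M]) auto
qed

lemma test_function_integrable:
  assumes "\<phi> \<in> test_functions {c<..<d}"
  shows "integrable lborel \<phi>" and "\<phi> \<in> borel_measurable borel" and "\<exists>M\<ge>0. \<forall>t. \<bar>\<phi> t\<bar> \<le> M"
    and "integrable lborel (deriv \<phi>)" and "deriv \<phi> \<in> borel_measurable borel"
    and "\<exists>M\<ge>0. \<forall>t. \<bar>deriv \<phi> t\<bar> \<le> M"
  using continuous_supported_integrable[of \<phi> c d] continuous_supported_integrable[of "deriv \<phi>" c d]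
    test_function_properties[OF assms] by blast+

lemma test_function_eq_rl_integral_deriv:
  assumes "\<phi> \<in> test_functions {c<..<d}"
  shows "\<phi> = rl_integral 1 (deriv \<phi>)"
proof
  fix t
  note \<phi> = test_function_properties[OF assms]
  have d0: "deriv \<phi> s = 0" if "s \<le> c" for s
    using that by (intro \<phi>(5)) simp
  show "\<phi> t = rl_integral 1 (deriv \<phi>) t"
  proof (cases "t \<le> c")
    case True
    then show ?thesis
      using \<phi>(4)[of t] d0 by (subst rl_integral_eq_0) auto
  next
    case False
    have int: "integrable lborel (\<lambda>s. rl_kernel 1 (t - s) * deriv \<phi> s)" for t
      by (rule rl_kernel_mult_integrable[OF _ continuous_supported_integrable(1)[OF \<phi>(2,5)] d0]) auto
    have "(deriv \<phi> has_integral (\<phi> t - \<phi> c)) {c..t}"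
      using False \<phi>(3)
      by (intro fundamental_theorem_of_calculus)
         (auto intro: has_field_derivative_at_within simp: has_real_derivative_iff_has_vector_derivative[symmetric])
    moreover have "\<phi> c = 0" and "rl_integral 1 (deriv \<phi>) c = 0"
      using \<phi>(4)[of c] d0 by (auto intro: rl_integral_eq_0)
    ultimately show ?thesis
      using rl_integral_1_diff(2)[OF int, of c t] False by (simp add: integral_unique)
  qed
qed

text \<open>For \<open>\<alpha> < 1\<close> one has \<open>\<phi> = J\<^sup>1 \<phi>'\<close>, hence \<open>J\<^sup>1\<^sup>-\<^sup>\<alpha> \<phi> = J\<^sup>1 J\<^sup>1\<^sup>-\<^sup>\<alpha> \<phi>'\<close> and the fractional derivative is
  \<open>J\<^sup>1\<^sup>-\<^sup>\<alpha> \<phi>'\<close> (Riemann-Liouville and Caputo derivatives agree on test functions). For \<open>\<alpha> = 1\<close> the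
  definition differentiates \<open>J\<^sup>1 \<phi>\<close> twice, which gives \<open>\<phi>'\<close>. In both cases applying \<open>J\<^sup>1\<^sup>+\<^sup>\<alpha>\<close> yields
  \<open>J\<^sup>2 \<phi>' = J\<^sup>1 \<phi>\<close>. The identity is confined to \<open>t \<le> d\<close> because the true \<open>D\<^sup>\<alpha> \<phi>\<close> need not vanish beyond
  \<open>d\<close>, whereas \<open>\<psi>\<close> is cut off there.\<close>

lemma test_function_frac_deriv:
  assumes \<phi>: "\<phi> \<in> test_functions {c<..<d}" and \<alpha>: "0 < \<alpha>" "\<alpha> \<le> 1" and "c < d"
  obtains \<psi> where "\<psi> \<in> borel_measurable borel" "\<And>s. s \<notin> {c<..<d} \<Longrightarrow> \<psi> s = 0"
    "\<exists>M. \<forall>s. \<bar>\<psi> s\<bar> \<le> M" "AE t in lborel. t \<in> {c<..<d} \<longrightarrow> frac_deriv \<alpha> \<phi> t = \<psi> t"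
    "\<And>t. t \<le> d \<Longrightarrow> rl_integral 1 \<phi> t = rl_integral (1 + \<alpha>) \<psi> t"
proof -
  note p = test_function_properties[OF \<phi>] and \<phi>_eq = test_function_eq_rl_integral_deriv[OF \<phi>]
  note [measurable] = test_function_integrable(2,5)[OF \<phi>]
  obtain M where M: "M \<ge> 0" "\<And>t. \<bar>deriv \<phi> t\<bar> \<le> M"
    using test_function_integrable(6)[OF \<phi>] by auto
  have d0: "deriv \<phi> s = 0" if "s \<le> c" for s
    using that by (intro p(5)) simp
  have int: "integrable lborel (\<lambda>s. rl_kernel \<gamma> (t - s) * deriv \<phi> s)" if "1 \<le> \<gamma>" for \<gamma> t
    using that test_function_integrable(4)[OF \<phi>] d0 by (rule rl_kernel_mult_integrable)
  have J: "rl_integral 1 \<phi> t = rl_integral 2 (deriv \<phi>) t" for t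
    using rl_integral_semigroup(2)[of 1 1 "deriv \<phi>" t] int[of 2 t] \<phi>_eq by simp
  show thesis
  proof (cases "\<alpha> = 1")
    case True
    have int\<phi>: "integrable lborel (\<lambda>s. rl_kernel 1 (t - s) * \<phi> s)" for t
      by (rule rl_kernel_mult_integrable[OF _ test_function_integrable(1)[OF \<phi>], of 1 c])
         (use p(4) in auto)
    have G: "(\<lambda>\<tau>. LINT s:{..\<tau>}|lebesgue. (\<tau> - s) powr (real 2 - 1 - 1) * \<phi> s) = rl_integral 1 \<phi>"
    proof
      fix \<tau>
      show "(LINT s:{..\<tau>}|lebesgue. (\<tau> - s) powr (real 2 - 1 - 1) * \<phi> s) = rl_integral 1 \<phi> \<tau>"
        using frac_integral_eq_rl_integral[of 1 \<phi> "\<tau> + 1" \<phi> \<tau>] by simp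
    qed
    have "deriv (rl_integral 1 \<phi>) = \<phi>"
      using rl_integral_1_has_derivative_continuous[OF int\<phi> p(1)] by (auto intro!: DERIV_imp_deriv)
    then have fd: "frac_deriv \<alpha> \<phi> t = deriv \<phi> t" for t
      using G True by (simp add: frac_deriv_def numeral_2_eq_2)
    show thesis
    proof (rule that[of "deriv \<phi>"])
      show "rl_integral 1 \<phi> t = rl_integral (1 + \<alpha>) (deriv \<phi>) t" for t
        using J True by simp
    qed (use M p(5) fd in auto)
  next
    case False
    with \<alpha> have "\<alpha> < 1" by simp
    let ?\<psi> = "rl_integral (1 - \<alpha>) (deriv \<phi>)"
    have sg: "rl_integral (1 - \<alpha>) \<phi> \<tau> = rl_integral 1 ?\<psi> \<tau>"
      and \<psi>_int: "integrable lborel (\<lambda>r. rl_kernel 1 (\<tau> - r) * ?\<psi> r)" for \<tau>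
      using rl_integral_semigroup[of 1 "1 - \<alpha>" "deriv \<phi>" \<tau>] rl_integral_semigroup(2)[of "1 - \<alpha>" 1 "deriv \<phi>" \<tau>]
        int[of "2 - \<alpha>" \<tau>] \<open>\<alpha> < 1\<close> \<phi>_eq by (simp_all add: algebra_simps)
    have sg': "rl_integral (1 - \<alpha>) \<phi> = rl_integral 1 ?\<psi>"
      using sg by (rule ext)
    have fd: "AE t in lborel. frac_deriv \<alpha> \<phi> t = ?\<psi> t"
      using rl_integral_1_has_derivative_AE[OF \<psi>_int]
    proof eventually_elim
      case (elim t)
      show ?case
        by (rule frac_deriv_eqI[of _ \<phi> "t + 1"]) (use \<alpha> \<open>\<alpha> < 1\<close> elim sg' in auto)
    qed
    have J2: "rl_integral 1 \<phi> t = rl_integral (1 + \<alpha>) ?\<psi> t" for t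
      using rl_integral_semigroup(2)[of "1 + \<alpha>" "1 - \<alpha>" "deriv \<phi>" t] int[of 2 t] \<alpha> \<open>\<alpha> < 1\<close> J by simp
    show thesis
    proof (rule that[of "\<lambda>s. indicator {c<..<d} s * ?\<psi> s"])
      have "\<bar>indicator {c<..<d} s * ?\<psi> s\<bar> \<le> M * rl_kernel (1 - \<alpha> + 1) (d - c)" for s
        using rl_integral_bounded[of "1 - \<alpha>" c d M "deriv \<phi>" s] \<open>\<alpha> < 1\<close> \<open>c < d\<close> M d0
        by (auto simp: indicator_def rl_kernel_nonneg)
      then show "\<exists>M. \<forall>s. \<bar>indicator {c<..<d} s * ?\<psi> s\<bar> \<le> M"
        by blast
      show "AE t in lborel. t \<in> {c<..<d} \<longrightarrow> frac_deriv \<alpha> \<phi> t = indicator {c<..<d} t * ?\<psi> t"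
        using fd by eventually_elim simp
      show "rl_integral 1 \<phi> t = rl_integral (1 + \<alpha>) (\<lambda>s. indicator {c<..<d} s * ?\<psi> s) t" if "t \<le> d" for t
      proof -
        have "?\<psi> s = indicator {c<..<d} s * ?\<psi> s" if "s < t" for s
          using \<open>t \<le> d\<close> that d0 by (cases "s \<le> c") (auto intro!: rl_integral_eq_0)
        then show ?thesis
          unfolding J2 by (rule rl_integral_cong)
      qed
    qed auto
  qed
qed

section \<open>The semigroup law on the closure of the test functions\<close>

text \<open>Elements of the closure are fractional integrals of their fractional derivatives: the identity
  \<open>J\<^sup>1 \<phi> = J\<^sup>1\<^sup>+\<^sup>\<alpha> D\<^sup>\<alpha> \<phi>\<close> for test functions survives the limit, and differentiating it removes one order
  of integration on both sides.\<close>

lemma frac_space_representation: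
  assumes x: "x \<in> frac_space \<alpha> {c<..<d}" and \<alpha>: "0 < \<alpha>" "\<alpha> \<le> 1" and "c < d"
  obtains g where "g \<in> borel_measurable borel" "integrable lborel g" "\<And>s. s \<le> c \<Longrightarrow> g s = 0"
    "AE t in lborel. t \<in> {c<..<d} \<longrightarrow> frac_deriv \<alpha> x t = g t"
    "AE t in lborel. t < d \<longrightarrow> x t = rl_integral \<alpha> g t"
proof -
  let ?I = "{c<..<d}"
  from x obtain \<phi> where x0: "\<And>t. t \<notin> ?I \<Longrightarrow> x t = 0" and xL: "x \<in> L2 ?I" and DL: "frac_deriv \<alpha> x \<in> L2 ?I"
    and \<phi>: "\<And>k. \<phi> k \<in> test_functions ?I"
    and lim: "(\<lambda>k. sqrt ((L2_nrm ?I (\<lambda>t. \<phi> k t - x t))\<^sup>2 +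
                (L2_nrm ?I (\<lambda>t. frac_deriv \<alpha> (\<phi> k) t - frac_deriv \<alpha> x t))\<^sup>2)) \<longlonglongrightarrow> 0" (is "?n \<longlonglongrightarrow> 0")
    unfolding frac_space_def by blast
  obtain f where f[measurable]: "f \<in> borel_measurable borel" and f0: "\<And>s. s \<notin> ?I \<Longrightarrow> f s = 0"
    and fx: "AE s in lborel. s \<in> ?I \<longrightarrow> x s = f s" and f2: "integrable lborel (\<lambda>s. (f s)\<^sup>2)"
    using L2_borel_representative[OF xL] by blast
  obtain g where g[measurable]: "g \<in> borel_measurable borel" and g0: "\<And>s. s \<notin> ?I \<Longrightarrow> g s = 0"
    and gx: "AE s in lborel. s \<in> ?I \<longrightarrow> frac_deriv \<alpha> x s = g s" and g2: "integrable lborel (\<lambda>s. (g s)\<^sup>2)"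
    using L2_borel_representative[OF DL] by blast
  have fi: "integrable lborel f"
    using \<open>c < d\<close> f f0 f2 by (rule L1_le_L2_on_interval)
  have gi: "integrable lborel g"
    using \<open>c < d\<close> g g0 g2 by (rule L1_le_L2_on_interval)
  have "\<forall>k. \<exists>\<psi>. \<psi> \<in> borel_measurable borel \<and> (\<forall>s. s \<notin> ?I \<longrightarrow> \<psi> s = 0) \<and> (\<exists>M. \<forall>s. \<bar>\<psi> s\<bar> \<le> M) \<and>
      (AE t in lborel. t \<in> ?I \<longrightarrow> frac_deriv \<alpha> (\<phi> k) t = \<psi> t) \<and>
      (\<forall>t\<le>d. rl_integral 1 (\<phi> k) t = rl_integral (1 + \<alpha>) \<psi> t)" (is "\<forall>k. ?P k")
  proof
    fix k
    show "?P k"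
      by (rule test_function_frac_deriv[OF \<phi>[of k] \<alpha> \<open>c < d\<close>]) blast
  qed
  from choice[OF this] obtain \<psi> where \<psi>[measurable]: "\<And>k. \<psi> k \<in> borel_measurable borel"
    and \<psi>0: "\<And>k s. s \<notin> ?I \<Longrightarrow> \<psi> k s = 0" and \<psi>M: "\<And>k. \<exists>M. \<forall>s. \<bar>\<psi> k s\<bar> \<le> M"
    and \<psi>D: "\<And>k. AE t in lborel. t \<in> ?I \<longrightarrow> frac_deriv \<alpha> (\<phi> k) t = \<psi> k t"
    and \<psi>J: "\<And>k t. t \<le> d \<Longrightarrow> rl_integral 1 (\<phi> k) t = rl_integral (1 + \<alpha>) (\<psi> k) t"
    by blast
  note p = test_function_properties[OF \<phi>]
  have N: "\<exists>N. \<forall>s. \<bar>\<phi> k s\<bar> \<le> N" for k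
    using test_function_integrable(3)[OF \<phi>[of k]] by blast
  have \<phi>m[measurable]: "\<phi> k \<in> borel_measurable borel" for k
    by (rule test_function_integrable(2)[OF \<phi>])
  have "(\<lambda>k. L2_nrm ?I (\<lambda>t. \<phi> k t - x t)) \<longlonglongrightarrow> 0"
    and "(\<lambda>k. L2_nrm ?I (\<lambda>t. frac_deriv \<alpha> (\<phi> k) t - frac_deriv \<alpha> x t)) \<longlonglongrightarrow> 0"
    by (rule Lim_null_comparison[OF always_eventually[OF allI] lim]; simp add: real_sqrt_ge_abs1 real_sqrt_ge_abs2)+
  note nrm_lim = this
  have lim1: "(\<lambda>k. LINT s|lborel. \<bar>\<phi> k s - f s\<bar>) \<longlonglongrightarrow> 0"
    using \<open>c < d\<close> f f0 f2 fx \<phi>m p(4) N _ nrm_lim(1) by (rule L1_tendsto_if_L2_nrm_tendsto) simp_all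
  have lim2: "(\<lambda>k. LINT s|lborel. \<bar>\<psi> k s - g s\<bar>) \<longlonglongrightarrow> 0"
    using \<open>c < d\<close> g g0 g2 gx \<psi> \<psi>0 \<psi>M \<psi>D nrm_lim(2) by (rule L1_tendsto_if_L2_nrm_tendsto)
  have \<psi>i: "integrable lborel (\<psi> k)" for k
    using \<psi> \<psi>0 \<psi>M by (rule bounded_supported_integrable)
  have fg: "rl_integral 1 f t = rl_integral (1 + \<alpha>) g t" if "t \<le> d" for t
  proof (rule LIMSEQ_unique)
    show "(\<lambda>k. rl_integral 1 (\<phi> k) t) \<longlonglongrightarrow> rl_integral 1 f t"
      by (rule rl_integral_tendsto[where c = c])
         (use fi f0 p(4) lim1 test_function_integrable(1)[OF \<phi>] in auto)
    have "(\<lambda>k. rl_integral (1 + \<alpha>) (\<psi> k) t) \<longlonglongrightarrow> rl_integral (1 + \<alpha>) g t"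
      by (rule rl_integral_tendsto[where c = c])
         (use \<alpha> gi g0 \<psi>0 lim2 \<psi>i in auto)
    with that show "(\<lambda>k. rl_integral 1 (\<phi> k) t) \<longlonglongrightarrow> rl_integral (1 + \<alpha>) g t"
      by (simp add: \<psi>J)
  qed
  have g_int: "integrable lborel (\<lambda>s. rl_kernel (1 + \<alpha>) (t - s) * g s)" for t
    by (rule rl_kernel_mult_integrable[OF _ gi, of _ c]) (use \<alpha> g0 in auto)
  note sg = rl_integral_semigroup[OF zero_less_one \<alpha>(1) g g_int]
  have f_int: "integrable lborel (\<lambda>s. rl_kernel 1 (t - s) * f s)" for t
    by (rule rl_kernel_mult_integrable[OF _ fi, of _ c]) (use f0 in auto)
  \<comment> \<open>Two primitives that agree near \<open>t\<close> have the same derivative there.\<close>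
  have "AE t in lborel. t < d \<longrightarrow> f t = rl_integral \<alpha> g t"
    using rl_integral_1_has_derivative_AE[OF f_int] rl_integral_1_has_derivative_AE[OF sg(1)]
  proof eventually_elim
    case (elim t)
    show ?case
    proof
      assume "t < d"
      have "(rl_integral 1 f has_real_derivative rl_integral \<alpha> g t) (at t)"
        using elim(2) by (rule has_field_derivative_transform_within_open[of _ _ _ "{..<d}"])
          (use \<open>t < d\<close> fg sg(2) in auto)
      with elim(1) show "f t = rl_integral \<alpha> g t"
        by (rule DERIV_unique)
    qed
  qed
  then have "AE t in lborel. t < d \<longrightarrow> x t = rl_integral \<alpha> g t"
    using fx by eventually_elim (use x0 f0 in fastforce)
  with g gi g0 gx show thesis
    by (intro that) auto
qed

text \<open>In terms of \<open>x = J\<^sup>\<alpha> g\<close> the inner derivative is \<open>J\<^sup>\<sigma> g\<close> and the outer one is \<open>g\<close>. The first of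
  these must be known on all of \<open>]-\<infinity>, d[\<close>, since the outer derivative integrates over it from \<open>-\<infinity>\<close>.\<close>

lemma frac_deriv_semigroup:
  assumes x: "x \<in> frac_space \<alpha> {c<..<d}" and \<sigma>: "0 < \<sigma>" "\<sigma> < \<alpha>" "\<alpha> \<le> 1" and "c < d"
  shows "AE t in lborel. t \<in> {c<..<d} \<longrightarrow> frac_deriv \<sigma> (frac_deriv (\<alpha> - \<sigma>) x) t = frac_deriv \<alpha> x t"
proof -
  obtain g where g[measurable]: "g \<in> borel_measurable borel" and gi: "integrable lborel g"
    and g0: "\<And>s. s \<le> c \<Longrightarrow> g s = 0"
    and gD: "AE t in lborel. t \<in> {c<..<d} \<longrightarrow> frac_deriv \<alpha> x t = g t"
    and gx: "AE t in lborel. t < d \<longrightarrow> x t = rl_integral \<alpha> g t"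
    using frac_space_representation[OF x less_trans[OF \<sigma>(1,2)] \<sigma>(3) \<open>c < d\<close>] by blast
  have g_int: "integrable lborel (\<lambda>s. rl_kernel \<gamma> (t - s) * g s)" if "1 \<le> \<gamma>" for \<gamma> t
    using that gi g0 by (rule rl_kernel_mult_integrable)
  have "1 \<le> 1 + \<sigma>"
    using \<sigma> by simp
  note J\<sigma> = rl_integral_semigroup[OF zero_less_one \<sigma>(1) g g_int[OF this]]
  have inner: "rl_integral (1 - (\<alpha> - \<sigma>)) (rl_integral \<alpha> g) = rl_integral 1 (rl_integral \<sigma> g)"
  proof
    fix t
    show "rl_integral (1 - (\<alpha> - \<sigma>)) (rl_integral \<alpha> g) t = rl_integral 1 (rl_integral \<sigma> g) t"
      using rl_integral_semigroup(2)[of "1 - (\<alpha> - \<sigma>)" \<alpha> g t] J\<sigma>(2)[of t] g_int[of "1 + \<sigma>" t] \<sigma> by simp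
  qed
  have "AE t in lborel. (rl_integral 1 (rl_integral \<sigma> g) has_real_derivative rl_integral \<sigma> g t) (at t)"
    by (rule rl_integral_1_has_derivative_AE[OF J\<sigma>(1)])
  then have inner_D: "AE t in lborel. t < d \<longrightarrow> frac_deriv (\<alpha> - \<sigma>) x t = rl_integral \<sigma> g t"
  proof eventually_elim
    case (elim t)
    then show ?case
      using \<sigma> inner by (intro impI frac_deriv_eqI[OF _ _ _ gx]) auto
  qed
  have outer: "rl_integral (1 - \<sigma>) (rl_integral \<sigma> g) = rl_integral 1 g"
  proof
    fix t
    show "rl_integral (1 - \<sigma>) (rl_integral \<sigma> g) t = rl_integral 1 g t"
      using rl_integral_semigroup(2)[of "1 - \<sigma>" \<sigma> g t] g_int[of 1 t] \<sigma> by simp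
  qed
  have "AE t in lborel. (rl_integral 1 g has_real_derivative g t) (at t)"
    by (rule rl_integral_1_has_derivative_AE[OF g_int]) simp
  then have "AE t in lborel. t < d \<longrightarrow> frac_deriv \<sigma> (frac_deriv (\<alpha> - \<sigma>) x) t = g t"
  proof eventually_elim
    case (elim t)
    then show ?case
      using \<sigma> outer by (intro impI frac_deriv_eqI[OF _ _ _ inner_D]) auto
  qed
  with gD show ?thesis
    by eventually_elim auto
qed

section \<open>The embedded Euler-Lagrange equation\<close>

text \<open>The second space derivative has to exist for
  \<open>\<partial>\<^sub>x (- a\<^sup>2 u\<^sub>x) = - a\<^sup>2 u\<^sub>x\<^sub>x\<close>: where \<^const>\<open>deriv\<close> has no derivative to return, it need not be linear.\<close>

lemma frac_embedding_quadratic: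
  assumes "deriv (u t) field_differentiable (at x)"
  shows "frac_embedding \<sigma> (\<lambda>t x y v w. 1/2 * v\<^sup>2 - a\<^sup>2/2 * w\<^sup>2) u t x \<longleftrightarrow>
    frac_deriv \<sigma> (frac_deriv \<sigma> (\<lambda>s. u s x)) t = a\<^sup>2 * deriv (deriv (u t)) x"
proof -
  have "deriv (\<lambda>v::real. 1/2 * v\<^sup>2 - k) v = v" for k v
    by (rule DERIV_imp_deriv) (auto intro!: derivative_eq_intros)
  moreover have "deriv (\<lambda>w::real. k - a\<^sup>2/2 * w\<^sup>2) w = - a\<^sup>2 * w" for k w
    by (rule DERIV_imp_deriv) (auto intro!: derivative_eq_intros)
  moreover have "deriv (\<lambda>\<xi>. - a\<^sup>2 * deriv (u t) \<xi>) x = - a\<^sup>2 * deriv (deriv (u t)) x"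
    using assms by (rule deriv_cmult)
  ultimately show ?thesis
    unfolding frac_embedding_def euler_lagrange_def Let_def by auto
qed

theorem theorem8p10:
  fixes \<alpha> a c d :: real and X :: "real set" and u :: "real \<Rightarrow> real \<Rightarrow> real"
  assumes "0 < \<alpha>" and "\<alpha> \<le> 1" and "c < d" and "open X"
    and "\<And>x. x \<in> X \<Longrightarrow> (\<lambda>t. u t x) \<in> frac_space \<alpha> {c<..<d}"
    and "AE t in lebesgue_on {c<..<d}. \<forall>x\<in>X.
           u t field_differentiable (at x) \<and> deriv (u t) field_differentiable (at x)"
  shows "\<forall>x\<in>X. AE t in lebesgue_on {c<..<d}.
           frac_embedding (\<alpha>/2) (\<lambda>t x y v w. 1/2 * v\<^sup>2 - a\<^sup>2/2 * w\<^sup>2) u t x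
           \<longleftrightarrow> frac_diffusion \<alpha> a u t x"
proof
  fix x
  assume "x \<in> X"
  have "AE t in lborel. t \<in> {c<..<d} \<longrightarrow>
      frac_deriv (\<alpha>/2) (frac_deriv (\<alpha>/2) (\<lambda>s. u s x)) t = frac_deriv \<alpha> (\<lambda>s. u s x) t"
    using frac_deriv_semigroup[OF assms(5)[OF \<open>x \<in> X\<close>], of "\<alpha>/2"] assms(1-3) by simp
  then have "AE t in lebesgue_on {c<..<d}.
      frac_deriv (\<alpha>/2) (frac_deriv (\<alpha>/2) (\<lambda>s. u s x)) t = frac_deriv \<alpha> (\<lambda>s. u s x) t"
    using AE_completion by (auto simp: AE_restrict_space_iff)
  with assms(6) show "AE t in lebesgue_on {c<..<d}.
      frac_embedding (\<alpha>/2) (\<lambda>t x y v w. 1/2 * v\<^sup>2 - a\<^sup>2/2 * w\<^sup>2) u t x \<longleftrightarrow> frac_diffusion \<alpha> a u t x"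
  proof eventually_elim
    case (elim t)
    then show ?case
      using \<open>x \<in> X\<close> frac_embedding_quadratic[of u t x "\<alpha>/2" a] by (simp add: frac_diffusion_def)
  qed
qed

end
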